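(* Let $\alpha,\beta\ge0$ with $\alpha+\beta>0$. The space $\mathcal D_{\alpha,\beta}$ is invariant under the basic Cartesian product cosine family $\{C_{\mathrm D}(t),\,t\in\mathbb R\}$, i.e. $C_{\mathrm D}(t)\mathcal D_{\alpha,\beta}\subset\mathcal D_{\alpha,\beta}$ for all $t\in\mathbb R$.
   Context: $\mathfrak C[-\infty,\infty]$ is the space of real continuous functions on $\mathbb R$ with finite limits at $\pm\infty$; $\mathcal C=(\mathfrak C[-\infty,\infty])^2$. $C(t)f(x)=\frac12[f(x+t)+f(x-t)]$ and $C_{\mathrm D}(t)(f_1,f_2)=(C(t)f_1,C(t)f_2)$ for $(f_1,f_2)\in\mathcal C$, $t\in\mathbb R$. For a function $f$ on $\mathbb R$: $f^{T}(x)=f(-x)$, $f^e=\frac12(f+f^{T})$. $e_a(x)=e^{-ax}$; $(f*g)(x)=\int_0^x f(x-y)g(y)\,dy$ for all $x\in\mathbb R$. $\mathcal D_{\alpha,\beta}$ is the space of $(g_1,g_2)\in\mathcal C$ such that, on $\mathbb R$, $$g_1^e=-g_2(0)e_{\alpha+\beta}-e_{\alpha+\beta}*(\beta g_2-\alpha g_1^{T}),\qquad g_2^e=g_2(0)e_{\alpha+\beta}+e_{\alpha+\beta}*(\beta g_2-\alpha g_1^{T}).$$ *)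

theory Defs
  imports "HOL-Analysis.Analysis"
begin

definition cont_lim :: "(real \<Rightarrow> real) set" where
  "cont_lim = {f. continuous_on UNIV f \<and> (\<exists>l. (f \<longlongrightarrow> l) at_top) \<and> (\<exists>l. (f \<longlongrightarrow> l) at_bot)}"

definition cont_lim_pairs :: "((real \<Rightarrow> real) \<times> (real \<Rightarrow> real)) set" where
  "cont_lim_pairs = cont_lim \<times> cont_lim"

definition cosine :: "real \<Rightarrow> (real \<Rightarrow> real) \<Rightarrow> real \<Rightarrow> real" where
  "cosine t f = (\<lambda>x. (f (x + t) + f (x - t)) / 2)"

definition cosine_pair ::
  "real \<Rightarrow> (real \<Rightarrow> real) \<times> (real \<Rightarrow> real) \<Rightarrow> (real \<Rightarrow> real) \<times> (real \<Rightarrow> real)" where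
  "cosine_pair t = (\<lambda>(f1, f2). (cosine t f1, cosine t f2))"

definition reflect :: "(real \<Rightarrow> real) \<Rightarrow> real \<Rightarrow> real" where
  "reflect f = (\<lambda>x. f (- x))"

definition even_part :: "(real \<Rightarrow> real) \<Rightarrow> real \<Rightarrow> real" where
  "even_part f = (\<lambda>x. (f x + reflect f x) / 2)"

definition expo :: "real \<Rightarrow> real \<Rightarrow> real" where
  "expo a = (\<lambda>x. exp (- a * x))"

text \<open>The interval integral is oriented: for negative \<open>x\<close> it is minus the integral
  over the interval from \<open>x\<close> to \<open>0\<close>, as the convolution on the whole line requires.\<close>

definition conv :: "(real \<Rightarrow> real) \<Rightarrow> (real \<Rightarrow> real) \<Rightarrow> real \<Rightarrow> real" where
  "conv f g = (\<lambda>x. LBINT y=0..x. f (x - y) * g y)"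

definition D_space :: "real \<Rightarrow> real \<Rightarrow> ((real \<Rightarrow> real) \<times> (real \<Rightarrow> real)) set" where
  "D_space \<alpha> \<beta> = {(g1, g2). (g1, g2) \<in> cont_lim_pairs \<and>
     (\<forall>x. even_part g1 x =
        - g2 0 * expo (\<alpha> + \<beta>) x
        - conv (expo (\<alpha> + \<beta>)) (\<lambda>y. \<beta> * g2 y - \<alpha> * reflect g1 y) x) \<and>
     (\<forall>x. even_part g2 x =
        g2 0 * expo (\<alpha> + \<beta>) x
        + conv (expo (\<alpha> + \<beta>)) (\<lambda>y. \<beta> * g2 y - \<alpha> * reflect g1 y) x)}"

end

theory Submission
  imports Defs
begin

text \<open>Variation of constants turns the two convolution equations into
  \<open>g\<^sub>1\<^sup>e = - g\<^sub>2\<^sup>e\<close> together with the linear differential equation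
  \<open>u' = \<beta> g\<^sub>2 - \<alpha> g\<^sub>1\<^sup>T - (\<alpha> + \<beta>) u\<close> for \<open>u = g\<^sub>2\<^sup>e\<close>; the initial condition
  \<open>u(0) = g\<^sub>2(0)\<close> is automatic. Both conditions are linear and translation invariant up to
  reflection, and \<open>C(t)\<close> commutes with differentiation and with reflection.\<close>

text \<open>Reflection merely swaps the shifts by \<open>t\<close> and \<open>- t\<close>, in which
  \<open>cosine\<close> is symmetric.\<close>

lemma even_part_cosine: "even_part (cosine t f) = cosine t (even_part f)"
  by (simp add: even_part_def cosine_def reflect_def fun_eq_iff field_simps)

lemma cosine_in_cont_lim:
  assumes "f \<in> cont_lim"
  shows "cosine t f \<in> cont_lim"
proof -
  from assms obtain l m where c: "continuous_on UNIV f"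
    and l: "(f \<longlongrightarrow> l) at_top" and m: "(f \<longlongrightarrow> m) at_bot"
    by (auto simp: cont_lim_def)
  \<comment> \<open>Both shifts have the limits of \<open>f\<close> itself, so averaging them keeps
    \<open>l\<close> and \<open>m\<close>.\<close>
  have shift: "((\<lambda>x. f (x + s)) \<longlongrightarrow> l) at_top" "((\<lambda>x. f (x + s)) \<longlongrightarrow> m) at_bot" for s
  proof -
    have "filterlim (\<lambda>x::real. x + s) at_top at_top"
      unfolding filterlim_at_top eventually_at_top_linorder
      by (metis add_right_mono diff_add_cancel)
    then show "((\<lambda>x. f (x + s)) \<longlongrightarrow> l) at_top"
      by (rule filterlim_compose[OF l])
    have "filterlim (\<lambda>x::real. x + s) at_bot at_bot"
      unfolding filterlim_at_bot eventually_at_bot_linorder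
      by (metis add_right_mono diff_add_cancel)
    then show "((\<lambda>x. f (x + s)) \<longlongrightarrow> m) at_bot"
      by (rule filterlim_compose[OF m])
  qed
  have "(cosine t f \<longlongrightarrow> l) at_top"
    using tendsto_divide[OF tendsto_add[OF shift(1)[of t] shift(1)[of "- t"]] tendsto_const[of 2]]
    by (simp add: cosine_def)
  moreover have "(cosine t f \<longlongrightarrow> m) at_bot"
    using tendsto_divide[OF tendsto_add[OF shift(2)[of t] shift(2)[of "- t"]] tendsto_const[of 2]]
    by (simp add: cosine_def)
  moreover have "continuous_on UNIV (cosine t f)"
    unfolding cosine_def by (intro continuous_intros continuous_on_compose2[OF c]) auto
  ultimately show ?thesis
    by (auto simp: cont_lim_def)
qed

lemma cosine_has_derivative:
  assumes "\<And>x. (u has_real_derivative v x) (at x)"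
  shows "(cosine t u has_real_derivative cosine t v x) (at x)"
proof -
  have "((\<lambda>x. u (x + s)) has_real_derivative v (x + s)) (at x)" for s
    using assms[of "x + s"] by (rule DERIV_shift[THEN iffD1])
  from DERIV_cdivide[OF DERIV_add[OF this[of t] this[of "- t"]], of 2] show ?thesis
    by (simp add: cosine_def)
qed

lemma interval_integral_has_derivative:
  fixes f :: "real \<Rightarrow> real"
  assumes "continuous_on UNIV f"
  shows "((\<lambda>x. LBINT y=0..x. f y) has_real_derivative f x) (at x)"
proof -
  \<comment> \<open>The compact interval contains the base point 0 whatever the sign of
    \<open>x\<close>. The margin 1 puts \<open>x\<close> in its interior, so the derivative within
    the interval is a two-sided one.\<close>
  define a b where "a = min 0 x - 1" and "b = max 0 x + 1"
  have ab: "a < x" "x < b" "a \<le> 0" "0 \<le> b"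
    by (auto simp: a_def b_def)
  have "((\<lambda>u. LBINT y=ereal 0..u. f y) has_vector_derivative f x) (at x within {a..b})"
    using ab by (intro interval_integral_FTC2 continuous_on_subset[OF assms]) auto
  then show ?thesis
    using ab by (simp add: has_real_derivative_iff_has_vector_derivative at_within_Icc_at
        zero_ereal_def)
qed

text \<open>Splitting the exponential frees the integrand of \<open>x\<close>, which then enters the
  integral only as its upper limit; differentiation reduces to the product rule and the fundamental
  theorem.\<close>

lemma conv_expo:
  "conv (expo a) h x = exp (- a * x) * (LBINT y=0..x. exp (a * y) * h y)"
proof -
  have "exp (- a * (x - y)) = exp (- a * x) * exp (a * y)" for y
    by (simp add: right_diff_distrib flip: exp_add)
  then show ?thesis
    unfolding conv_def expo_def by (simp add: mult.assoc)
qed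

text \<open>The integrating factor exp(a x) turns u' + a u = h into (exp(a x) u)' = exp(a x) h, and
  \<open>P\<close> is the antiderivative of the right side vanishing at 0. The oriented integral
  covers negative x as well.\<close>

lemma variation_of_constants_iff:
  fixes u h :: "real \<Rightarrow> real"
  assumes h: "continuous_on UNIV h"
  shows "(\<forall>x. u x = c * expo a x + conv (expo a) h x) \<longleftrightarrow>
    u 0 = c \<and> (\<forall>x. (u has_real_derivative h x - a * u x) (at x))"
    (is "?L \<longleftrightarrow> ?R")
proof -
  define P where "P x = (LBINT y=0..x. exp (a * y) * h y)" for x :: real
  have P0: "P 0 = 0"
    by (simp add: P_def zero_ereal_def)
  have P: "(P has_real_derivative exp (a * x) * h x) (at x)" for x
    unfolding P_def
    by (rule interval_integral_has_derivative) (intro continuous_intros h)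
  have rhs: "c * expo a x + conv (expo a) h x = exp (- a * x) * (c + P x)" for x
    unfolding conv_expo P_def unfolding expo_def by (simp add: algebra_simps)
  show ?thesis
  proof
    assume ?L
    then have u: "u = (\<lambda>x. exp (- a * x) * (c + P x))"
      by (simp add: rhs fun_eq_iff)
    have "(u has_real_derivative h x - a * u x) (at x)" for x
      unfolding u by (auto intro!: derivative_eq_intros P simp: algebra_simps exp_minus)
    then show ?R
      by (simp add: u P0)
  next
    assume R: ?R
    \<comment> \<open>For a solution \<open>u\<close> the two terms have the same derivative, so
      \<open>w\<close> keeps its value \<open>c\<close> at 0.\<close>
    define w where "w x = exp (a * x) * u x - P x" for x
    have "(w has_real_derivative 0) (at x)" for x
      unfolding w_def using R
      by (auto intro!: derivative_eq_intros P simp: algebra_simps)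
    then have "w x = w 0" for x
      by (intro DERIV_isconst_all) simp
    then have e: "exp (a * x) * u x = c + P x" for x
      using R by (simp add: w_def P0 diff_eq_eq)
    have "u x = exp (- a * x) * (c + P x)" for x
      unfolding e[symmetric] by (simp add: exp_minus)
    then show ?L
      by (simp add: rhs)
  qed
qed

text \<open>This form is local: it has neither an integral based at 0 nor the value
  \<open>g2 0\<close>, both of which would be awkward under shifts.\<close>

lemma D_space_iff:
  "(g1, g2) \<in> D_space \<alpha> \<beta> \<longleftrightarrow>
    g1 \<in> cont_lim \<and> g2 \<in> cont_lim \<and> (\<forall>x. even_part g1 x = - even_part g2 x) \<and>
    (\<forall>x. (even_part g2 has_real_derivative
      \<beta> * g2 x - \<alpha> * reflect g1 x - (\<alpha> + \<beta>) * even_part g2 x) (at x))"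
proof (cases "g1 \<in> cont_lim \<and> g2 \<in> cont_lim")
  case True
  then have cont: "continuous_on UNIV g1" "continuous_on UNIV g2"
    by (auto simp: cont_lim_def)
  have "continuous_on UNIV (\<lambda>x. \<beta> * g2 x - \<alpha> * reflect g1 x)"
    unfolding reflect_def
    by (intro continuous_intros cont(2) continuous_on_compose2[OF cont(1)]) auto
  note ode = variation_of_constants_iff[OF this, of "even_part g2" "g2 0" "\<alpha> + \<beta>"]
  have initial: "even_part g2 0 = g2 0"
    by (simp add: even_part_def reflect_def)
  \<comment> \<open>The two right sides are negatives of each other, so in the presence of the
    second equation the first only relates the even parts.\<close>
  have cancel: "(\<forall>x. p x = - c * q x - r x) \<and> (\<forall>x. s x = c * q x + r x) \<longleftrightarrow>
      (\<forall>x. p x = - s x) \<and> (\<forall>x. s x = c * q x + r x)"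
    for p q r s :: "real \<Rightarrow> real" and c
    by (rule iffI; clarsimp)
  show ?thesis
    unfolding D_space_def cont_lim_pairs_def mem_Collect_eq case_prod_conv cancel ode initial
    using True by simp
next
  case False
  then show ?thesis
    by (auto simp: D_space_def cont_lim_pairs_def)
qed

theorem theorem4p4:
  fixes \<alpha> \<beta> :: real
  assumes "\<alpha> \<ge> 0" and "\<beta> \<ge> 0" and "\<alpha> + \<beta> > 0"
  shows "\<forall>t::real. cosine_pair t ` D_space \<alpha> \<beta> \<subseteq> D_space \<alpha> \<beta>"
proof -
  have "(cosine t g1, cosine t g2) \<in> D_space \<alpha> \<beta>" if "(g1, g2) \<in> D_space \<alpha> \<beta>" for t g1 g2
  proof -
    define v where "v x = \<beta> * g2 x - \<alpha> * reflect g1 x - (\<alpha> + \<beta>) * even_part g2 x" for x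
    from that have mem: "g1 \<in> cont_lim" "g2 \<in> cont_lim"
      and even: "even_part g1 x = - even_part g2 x"
      and ode: "(even_part g2 has_real_derivative v x) (at x)" for x
      by (auto simp: D_space_iff v_def)
    \<comment> \<open>The right side of the differential equation for the new pair is
      \<open>cosine t v\<close>: its coefficients are constant, and \<open>reflect\<close> commutes
      with \<open>cosine t\<close>.\<close>
    have "cosine t v x = \<beta> * cosine t g2 x - \<alpha> * reflect (cosine t g1) x
        - (\<alpha> + \<beta>) * cosine t (even_part g2) x" for x
      by (simp add: v_def cosine_def reflect_def field_simps)
    with cosine_has_derivative[of "even_part g2" v t, OF ode] mem even show ?thesis
      by (simp add: D_space_iff cosine_in_cont_lim even_part_cosine)
        (simp add: cosine_def field_simps)
  qed
  then show ?thesis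
    by (auto simp: cosine_pair_def)
qed

end
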